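(* The adjoint operator $W^*: L^{\infty}([0,\infty))^* \to L^{\infty}([1,\infty))^*$ satisfies $W^*\mathcal{D}=\mathcal{C}$, and it restricts to an affine homeomorphism of $\mathcal{D}$ onto $\mathcal{C}$, where both sets carry the weak* topology.
   Context: $L^\infty$ spaces consist of real-valued essentially bounded measurable functions (Lebesgue measure). $W: L^{\infty}([1,\infty))\to L^{\infty}([0,\infty))$ is $(Wf)(x)=f(e^x)$, and $(W^*\varphi)(f)=\varphi(Wf)$. For $f\in L^{\infty}([1,\infty))$ put $M(f)=\lim_{x\to\infty}\frac1x\int_1^x f(t)\,dt$ whenever this limit exists, and let $E_0$ be the subspace of all $f$ for which $M(f)$ exists and equals $0$. $\mathcal{C}$ is the set of positive linear functionals of norm $1$ on $L^{\infty}([1,\infty))$ that vanish on $E_0$. For $f\in L^{\infty}([0,\infty))$ put $R(f)=\lim_{x\to\infty}\frac{1}{e^x}\int_0^x f(t)e^t\,dt$ whenever this limit exists, and let $F_0$ be the subspace of all $f$ for which $R(f)$ exists and equals $0$. $\mathcal{D}$ is the set of positive linear functionals of norm $1$ on $L^{\infty}([0,\infty))$ that vanish on $F_0$. *)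

theory Defs
  imports "HOL-Analysis.Analysis" "HOL-Probability.Essential_Supremum"
begin

section \<open>The space of essentially bounded functions modulo null sets\<close>

text \<open>
  The domain of the functions is carried by a phantom type, so that the spaces over different
  domains become types of class \<open>real_normed_vector\<close> and their duals are the types
  \<open>'a linf \<Rightarrow>\<^sub>L real\<close>. Representatives are total functions on the reals whose values outside
  the domain play no role.
\<close>

class domain_tag =
  fixes dom_of :: "'a itself \<Rightarrow> real set"
  assumes dom_of_lebesgue: "dom_of TYPE('a) \<in> sets lebesgue"

datatype from_zero = From_Zero
datatype from_one = From_One

instantiation from_zero :: domain_tag
begin
definition dom_of_from_zero :: "from_zero itself \<Rightarrow> real set"
  where "dom_of_from_zero _ = {0..}"
instance by standard (simp add: dom_of_from_zero_def)
end

instantiation from_one :: domain_tag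
begin
definition dom_of_from_one :: "from_one itself \<Rightarrow> real set"
  where "dom_of_from_one _ = {1..}"
instance by standard (simp add: dom_of_from_one_def)
end

abbreviation dom_measure :: "'a::domain_tag itself \<Rightarrow> real measure"
  where "dom_measure T \<equiv> lebesgue_on (dom_of T)"

definition ess_bounded :: "'a::domain_tag itself \<Rightarrow> (real \<Rightarrow> real) \<Rightarrow> bool"
  where "ess_bounded T f \<longleftrightarrow>
    f \<in> borel_measurable (dom_measure T) \<and> (\<exists>C. AE x in dom_measure T. \<bar>f x\<bar> \<le> C)"

definition linf_rel :: "'a::domain_tag itself \<Rightarrow> (real \<Rightarrow> real) \<Rightarrow> (real \<Rightarrow> real) \<Rightarrow> bool"
  where "linf_rel T f g \<longleftrightarrow>
    ess_bounded T f \<and> ess_bounded T g \<and> (AE x in dom_measure T. f x = g x)"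

lemma ess_bounded_const: "ess_bounded T (\<lambda>x. c)"
  unfolding ess_bounded_def by auto

lemma part_equivp_linf_rel: "part_equivp (linf_rel T)"
proof (rule part_equivpI)
  show "\<exists>f. linf_rel T f f"
    by (rule exI[of _ "\<lambda>x. 0"]) (simp add: linf_rel_def ess_bounded_const)
  show "symp (linf_rel T)"
    by (rule sympI) (auto simp: linf_rel_def elim: eventually_mono)
  show "transp (linf_rel T)"
    by (rule transpI) (auto simp: linf_rel_def elim: eventually_elim2)
qed

text \<open>
  The elements are the equivalence classes of almost everywhere equality. The lifting setup is
  done by hand because \<open>quotient_type\<close> does not accept a sort constraint on a type parameter
  that does not occur in the representing type.
\<close>

typedef (overloaded) ('a::domain_tag) linf =
  "{c. \<exists>f. linf_rel TYPE('a) f f \<and> c = Collect (linf_rel TYPE('a) f)}"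
  by (auto intro!: exI[of _ "\<lambda>x. 0"] simp: linf_rel_def ess_bounded_const)

definition abs_linf :: "(real \<Rightarrow> real) \<Rightarrow> 'a::domain_tag linf"
  where "abs_linf f = Abs_linf (Collect (linf_rel TYPE('a) f))"

definition rep_linf :: "'a::domain_tag linf \<Rightarrow> real \<Rightarrow> real"
  where "rep_linf c = (SOME f. f \<in> Rep_linf c)"

definition cr_linf :: "(real \<Rightarrow> real) \<Rightarrow> 'a::domain_tag linf \<Rightarrow> bool"
  where "cr_linf f c \<longleftrightarrow> linf_rel TYPE('a) f f \<and> abs_linf f = c"

lemma Quotient_linf:
  "Quotient (linf_rel TYPE('a::domain_tag)) abs_linf rep_linf (cr_linf :: _ \<Rightarrow> 'a linf \<Rightarrow> bool)"
proof -
  interpret q: quot_type "linf_rel TYPE('a)" Abs_linf "Rep_linf :: 'a linf \<Rightarrow> _"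
  proof
    show "part_equivp (linf_rel TYPE('a))" by (rule part_equivp_linf_rel)
    show "\<exists>f. linf_rel TYPE('a) f f \<and> Rep_linf c = Collect (linf_rel TYPE('a) f)" for c :: "'a linf"
      using Rep_linf[of c] by simp
    show "Abs_linf (Rep_linf c) = c" for c :: "'a linf" by (rule Rep_linf_inverse)
    show "Rep_linf (Abs_linf c :: 'a linf) = c"
      if "\<exists>f. linf_rel TYPE('a) f f \<and> c = Collect (linf_rel TYPE('a) f)" for c
      using that by (intro Abs_linf_inverse) simp
    show "(Rep_linf c = Rep_linf d) = (c = d)" for c d :: "'a linf" by (rule Rep_linf_inject)
  qed
  have "q.abs = abs_linf" "q.rep = rep_linf"
    by (simp_all add: fun_eq_iff q.abs_def q.rep_def abs_linf_def rep_linf_def)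
  then have "Quotient3 (linf_rel TYPE('a)) abs_linf (rep_linf :: 'a linf \<Rightarrow> _)"
    using q.Quotient by simp
  then show ?thesis
    by (rule Quotient3_to_Quotient) (simp add: fun_eq_iff cr_linf_def atomize_eq)
qed

setup_lifting Quotient_linf

lemma ess_bounded_add:
  assumes "ess_bounded T f" "ess_bounded T g"
  shows "ess_bounded T (\<lambda>x. f x + g x)"
proof -
  obtain C D where "AE x in dom_measure T. \<bar>f x\<bar> \<le> C" "AE x in dom_measure T. \<bar>g x\<bar> \<le> D"
    using assms unfolding ess_bounded_def by blast
  then have "AE x in dom_measure T. \<bar>f x + g x\<bar> \<le> C + D"
    by eventually_elim linarith
  then show ?thesis using assms unfolding ess_bounded_def by auto
qed

lemma ess_bounded_scale:
  assumes "ess_bounded T f"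
  shows "ess_bounded T (\<lambda>x. c * f x)"
proof -
  obtain C where "AE x in dom_measure T. \<bar>f x\<bar> \<le> C"
    using assms unfolding ess_bounded_def by blast
  then have "AE x in dom_measure T. \<bar>c * f x\<bar> \<le> \<bar>c\<bar> * C"
    by eventually_elim (simp add: abs_mult mult_left_mono)
  then show ?thesis using assms unfolding ess_bounded_def by auto
qed

lemma ess_bounded_minus: "ess_bounded T f \<Longrightarrow> ess_bounded T (\<lambda>x. - f x)"
  using ess_bounded_scale[of T f "- 1"] by simp

lemma ess_bounded_diff:
  "ess_bounded T f \<Longrightarrow> ess_bounded T g \<Longrightarrow> ess_bounded T (\<lambda>x. f x - g x)"
  using ess_bounded_add[OF _ ess_bounded_minus, of T f g] by simp

definition ess_norm :: "'a::domain_tag itself \<Rightarrow> (real \<Rightarrow> real) \<Rightarrow> real"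
  where "ess_norm T f = real_of_ereal (esssup (dom_measure T) (\<lambda>x. ereal \<bar>f x\<bar>))"

lemma ess_norm_properties:
  assumes "ess_bounded T f"
  shows ess_norm_nonneg: "0 \<le> ess_norm T f"
    and ess_norm_AE: "AE x in dom_measure T. \<bar>f x\<bar> \<le> ess_norm T f"
    and ess_norm_least: "\<And>C. 0 \<le> C \<Longrightarrow> AE x in dom_measure T. \<bar>f x\<bar> \<le> C \<Longrightarrow> ess_norm T f \<le> C"
proof -
  let ?M = "dom_measure T" and ?s = "esssup (dom_measure T) (\<lambda>x. ereal \<bar>f x\<bar>)"
  have m [measurable]: "f \<in> borel_measurable ?M" using assms by (simp add: ess_bounded_def)
  have le: "?s \<le> ereal C" if "AE x in ?M. \<bar>f x\<bar> \<le> C" for C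
    using that by (intro esssup_I) auto
  obtain C where "AE x in ?M. \<bar>f x\<bar> \<le> C" using assms by (auto simp: ess_bounded_def)
  then have fin: "?s \<noteq> \<infinity>" using le[of C] by auto
  have AE: "AE x in ?M. ereal \<bar>f x\<bar> \<le> ?s" by (rule esssup_AE)
  have cases: "?s = - \<infinity> \<and> (AE x in ?M. False) \<or> (\<exists>r\<ge>0. ?s = ereal r)"
  proof (cases "emeasure ?M (space ?M) = 0")
    case True
    then have "?s = - \<infinity>" by (intro esssup_zero_space) auto
    then show ?thesis using AE by auto
  next
    case False
    have "esssup ?M (\<lambda>x. 0::ereal) \<le> ?s" by (intro esssup_mono) auto
    then have "0 \<le> ?s" using esssup_const[OF False, of "0::ereal"] by simp
    then show ?thesis using fin by (cases ?s) auto
  qed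
  show "0 \<le> ess_norm T f" using cases by (auto simp: ess_norm_def)
  show "AE x in ?M. \<bar>f x\<bar> \<le> ess_norm T f"
    using cases AE by (auto simp: ess_norm_def)
  show "ess_norm T f \<le> C" if "0 \<le> C" "AE x in ?M. \<bar>f x\<bar> \<le> C" for C
    using cases le[OF that(2)] that(1) by (auto simp: ess_norm_def)
qed

lemma ess_norm_cong:
  assumes "linf_rel T f g"
  shows "ess_norm T f = ess_norm T g"
  using assms unfolding linf_rel_def ess_norm_def ess_bounded_def
  by (intro arg_cong[where f = real_of_ereal] esssup_AE_cong) auto

instantiation linf :: (domain_tag) real_normed_vector
begin

lift_definition zero_linf :: "'a linf" is "\<lambda>x. 0"
  by (simp add: linf_rel_def ess_bounded_const)

lift_definition plus_linf :: "'a linf \<Rightarrow> 'a linf \<Rightarrow> 'a linf" is "\<lambda>f g x. f x + g x"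
  by (auto simp: linf_rel_def ess_bounded_add)

lift_definition scaleR_linf :: "real \<Rightarrow> 'a linf \<Rightarrow> 'a linf" is "\<lambda>c f x. c * f x"
  by (auto simp: linf_rel_def ess_bounded_scale)

lift_definition uminus_linf :: "'a linf \<Rightarrow> 'a linf" is "\<lambda>f x. - f x"
  by (auto simp: linf_rel_def ess_bounded_minus)

lift_definition minus_linf :: "'a linf \<Rightarrow> 'a linf \<Rightarrow> 'a linf" is "\<lambda>f g x. f x - g x"
  by (auto simp: linf_rel_def ess_bounded_diff)

lift_definition norm_linf :: "'a linf \<Rightarrow> real" is "ess_norm TYPE('a)"
  by (rule ess_norm_cong)

definition sgn_linf :: "'a linf \<Rightarrow> 'a linf" where "sgn_linf f = scaleR (inverse (norm f)) f"

definition dist_linf :: "'a linf \<Rightarrow> 'a linf \<Rightarrow> real" where "dist_linf f g = norm (f - g)"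

definition uniformity_linf :: "('a linf \<times> 'a linf) filter"
  where "uniformity_linf = (INF e\<in>{0 <..}. principal {(f, g). dist f g < e})"

definition open_linf :: "'a linf set \<Rightarrow> bool"
  where "open_linf U \<longleftrightarrow>
    (\<forall>f\<in>U. eventually (\<lambda>(f', g). f' = f \<longrightarrow> g \<in> U) uniformity)"

instance
proof
  fix a b c :: "'a linf" and r s :: real
  show "a + b + c = a + (b + c)"
    by transfer (auto simp: linf_rel_def ess_bounded_add algebra_simps)
  show "a + b = b + a"
    by transfer (auto simp: linf_rel_def ess_bounded_add algebra_simps)
  show "0 + a = a"
    by transfer (auto simp: linf_rel_def)
  show "- a + a = 0"
    by transfer (auto simp: linf_rel_def ess_bounded_const)
  show "a - b = a + - b"
    by transfer (auto simp: linf_rel_def ess_bounded_diff)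
  show "r *\<^sub>R (a + b) = r *\<^sub>R a + r *\<^sub>R b"
    by transfer (auto simp: linf_rel_def algebra_simps intro!: ess_bounded_add ess_bounded_scale)
  show "(r + s) *\<^sub>R a = r *\<^sub>R a + s *\<^sub>R a"
    by transfer (auto simp: linf_rel_def distrib_right intro!: ess_bounded_add ess_bounded_scale)
  show "r *\<^sub>R s *\<^sub>R a = (r * s) *\<^sub>R a"
    by transfer (auto simp: linf_rel_def mult.assoc intro!: ess_bounded_scale)
  show "1 *\<^sub>R a = a"
    by transfer (auto simp: linf_rel_def)
  show "sgn a = scaleR (inverse (norm a)) a" by (rule sgn_linf_def)
  show "dist a b = norm (a - b)" by (rule dist_linf_def)
  show "uniformity = (INF e\<in>{0 <..}. principal {(x, y). dist (x::'a linf) y < e})"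
    by (rule uniformity_linf_def)
  show "open U \<longleftrightarrow> (\<forall>x\<in>U. \<forall>\<^sub>F (x', y) in uniformity. x' = x \<longrightarrow> y \<in> U)"
    for U :: "'a linf set" by (rule open_linf_def)
  show "norm a = 0 \<longleftrightarrow> a = 0"
  proof transfer
    fix f assume "linf_rel TYPE('a) f f"
    then have b: "ess_bounded TYPE('a) f" by (simp add: linf_rel_def)
    show "ess_norm TYPE('a) f = 0 \<longleftrightarrow> linf_rel TYPE('a) f (\<lambda>x. 0)"
    proof
      assume "ess_norm TYPE('a) f = 0"
      with ess_norm_AE[OF b] show "linf_rel TYPE('a) f (\<lambda>x. 0)"
        by (auto simp: linf_rel_def b ess_bounded_const)
    next
      assume "linf_rel TYPE('a) f (\<lambda>x. 0)"
      then have "AE x in dom_measure TYPE('a). \<bar>f x\<bar> \<le> 0" by (simp add: linf_rel_def)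
      from ess_norm_least[OF b _ this] ess_norm_nonneg[OF b]
      show "ess_norm TYPE('a) f = 0" by simp
    qed
  qed
  show "norm (a + b) \<le> norm a + norm b"
  proof transfer
    fix f g assume "linf_rel TYPE('a) f f" "linf_rel TYPE('a) g g"
    then have b: "ess_bounded TYPE('a) f" "ess_bounded TYPE('a) g" by (simp_all add: linf_rel_def)
    have "AE x in dom_measure TYPE('a). \<bar>f x + g x\<bar> \<le> ess_norm TYPE('a) f + ess_norm TYPE('a) g"
      using ess_norm_AE[OF b(1)] ess_norm_AE[OF b(2)] by eventually_elim linarith
    then show "ess_norm TYPE('a) (\<lambda>x. f x + g x) \<le> ess_norm TYPE('a) f + ess_norm TYPE('a) g"
      by (intro ess_norm_least ess_bounded_add b add_nonneg_nonneg ess_norm_nonneg)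
  qed
  have scale_le: "norm (t *\<^sub>R d) \<le> \<bar>t\<bar> * norm d" for t :: real and d :: "'a linf"
  proof transfer
    fix t f assume "linf_rel TYPE('a) f f"
    then have b: "ess_bounded TYPE('a) f" by (simp add: linf_rel_def)
    have "AE x in dom_measure TYPE('a). \<bar>t * f x\<bar> \<le> \<bar>t\<bar> * ess_norm TYPE('a) f"
      using ess_norm_AE[OF b] by eventually_elim (simp add: abs_mult mult_left_mono)
    then show "ess_norm TYPE('a) (\<lambda>x. t * f x) \<le> \<bar>t\<bar> * ess_norm TYPE('a) f"
      by (intro ess_norm_least ess_bounded_scale b mult_nonneg_nonneg ess_norm_nonneg) auto
  qed
  show "norm (r *\<^sub>R a) = \<bar>r\<bar> * norm a"
  proof (cases "r = 0")
    case True
    have "0 \<le> norm (r *\<^sub>R a)"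
      by transfer (auto simp: linf_rel_def intro!: ess_norm_nonneg ess_bounded_scale)
    with True scale_le[of r a] show ?thesis by simp
  next
    case False
    have "(1 / r) *\<^sub>R (r *\<^sub>R a) = a"
      using False by transfer (auto simp: linf_rel_def)
    with scale_le[of "1 / r" "r *\<^sub>R a"] False have "\<bar>r\<bar> * norm a \<le> norm (r *\<^sub>R a)"
      by (simp add: field_simps)
    with scale_le[of r a] show ?thesis by simp
  qed
qed

end

lift_definition nonneg_linf :: "'a::domain_tag linf \<Rightarrow> bool"
  is "\<lambda>f. AE x in dom_measure TYPE('a). 0 \<le> f x"
  by (auto simp: linf_rel_def elim: eventually_elim2)

definition positive_functional :: "('a::domain_tag linf \<Rightarrow>\<^sub>L real) \<Rightarrow> bool"
  where "positive_functional \<phi> \<longleftrightarrow> (\<forall>f. nonneg_linf f \<longrightarrow> 0 \<le> blinfun_apply \<phi> f)"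


section \<open>The operator \<open>W\<close> and adjoints\<close>

lemma ln_differentiable_on:
  assumes "A \<subseteq> {1::real..}"
  shows "ln differentiable_on A"
  unfolding differentiable_on_def
proof
  fix x assume "x \<in> A"
  then have "0 < x" using assms by force
  from DERIV_ln[OF this] have "ln differentiable at x"
    using real_differentiable_def by blast
  then show "ln differentiable at x within A" by (rule differentiable_at_withinI)
qed

lemma dom_of_simps: "dom_of TYPE(from_zero) = {0..}" "dom_of TYPE(from_one) = {1..}"
  by (rule dom_of_from_zero_def dom_of_from_one_def)+

lemma exp_measurable_half_lines:
  "exp \<in> lebesgue_on {0::real..} \<rightarrow>\<^sub>M lebesgue_on {1::real..}"
proof (rule measurableI)
  show "exp x \<in> space (lebesgue_on {1::real..})" if "x \<in> space (lebesgue_on {0::real..})" for x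
    using that by simp
  fix A :: "real set" assume "A \<in> sets (lebesgue_on {1..})"
  then have A: "A \<in> sets lebesgue" "A \<subseteq> {1..}" by (auto simp: sets_restrict_space_iff)
  have eq: "exp -` A \<inter> space (lebesgue_on {0..}) = ln ` A"
    using A(2) by (force simp: image_iff intro: bexI[where x = "exp _"])
  have "ln differentiable_on A"
    using A(2) by (rule ln_differentiable_on)
  then have "ln ` A \<in> sets lebesgue"
    by (intro differentiable_image_in_sets_lebesgue A) auto
  moreover have "ln ` A \<subseteq> {0..}" using A(2) by auto
  ultimately show "exp -` A \<inter> space (lebesgue_on {0..}) \<in> sets (lebesgue_on {0..})"
    unfolding eq by (simp add: sets_restrict_space_iff)
qed

lemma AE_exp:
  assumes "AE x in lebesgue_on {1::real..}. P x"
  shows "AE x in lebesgue_on {0::real..}. P (exp x)"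
proof -
  obtain N where N: "N \<in> null_sets (lebesgue_on {1..})"
    "{x \<in> space (lebesgue_on {1..}). \<not> P x} \<subseteq> N"
    using assms by (auto simp: eventually_ae_filter)
  then have N': "N \<in> null_sets lebesgue" "N \<subseteq> {1..}"
    by (auto simp: null_sets_restrict_space)
  have "ln differentiable_on N"
    using N'(2) by (rule ln_differentiable_on)
  then have "negligible (ln ` N)"
    using N' by (intro negligible_differentiable_image_negligible)
      (auto simp: negligible_iff_null_sets)
  then have "ln ` N \<in> null_sets (lebesgue_on {0..})"
    using N'(2) by (auto simp: null_sets_restrict_space negligible_iff_null_sets)
  moreover have "{x \<in> space (lebesgue_on {0..}). \<not> P (exp x)} \<subseteq> ln ` N"
    using N(2) by (force simp: image_iff intro: bexI[where x = "exp _"])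
  ultimately show ?thesis by (auto simp: eventually_ae_filter)
qed

lemma ess_bounded_exp:
  assumes "ess_bounded TYPE(from_one) f"
  shows "ess_bounded TYPE(from_zero) (\<lambda>x. f (exp x))"
proof -
  obtain C where "f \<in> borel_measurable (lebesgue_on {1..})" "AE x in lebesgue_on {1..}. \<bar>f x\<bar> \<le> C"
    using assms unfolding ess_bounded_def dom_of_simps by blast
  then show ?thesis
    using measurable_compose[OF exp_measurable_half_lines] AE_exp
    unfolding ess_bounded_def dom_of_simps by blast
qed

lift_definition W_fun :: "from_one linf \<Rightarrow> from_zero linf" is "\<lambda>f x. f (exp x)"
  using ess_bounded_exp AE_exp unfolding linf_rel_def dom_of_simps by blast

lift_definition W :: "from_one linf \<Rightarrow>\<^sub>L from_zero linf" is W_fun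
proof (rule bounded_linear_intro[where K = 1])
  show "W_fun (f + g) = W_fun f + W_fun g" for f g
    by transfer (auto simp: linf_rel_def intro!: ess_bounded_exp ess_bounded_add)
  show "W_fun (r *\<^sub>R f) = r *\<^sub>R W_fun f" for r f
    by transfer (auto simp: linf_rel_def intro!: ess_bounded_exp ess_bounded_scale)
  have "norm (W_fun f) \<le> norm f" for f
  proof transfer
    fix f assume "linf_rel TYPE(from_one) f f"
    then have b: "ess_bounded TYPE(from_one) f" by (simp add: linf_rel_def)
    have "AE x in dom_measure TYPE(from_zero). \<bar>f (exp x)\<bar> \<le> ess_norm TYPE(from_one) f"
      using AE_exp[of "\<lambda>x. \<bar>f x\<bar> \<le> ess_norm TYPE(from_one) f"] ess_norm_AE[OF b]
      unfolding dom_of_simps by blast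
    then show "ess_norm TYPE(from_zero) (\<lambda>x. f (exp x)) \<le> ess_norm TYPE(from_one) f"
      by (intro ess_norm_least ess_bounded_exp b ess_norm_nonneg)
  qed
  then show "norm (W_fun f) \<le> norm f * 1" for f by simp
qed

definition dual_map ::
  "('a::real_normed_vector \<Rightarrow>\<^sub>L 'b::real_normed_vector) \<Rightarrow> ('b \<Rightarrow>\<^sub>L real) \<Rightarrow> ('a \<Rightarrow>\<^sub>L real)"
  where "dual_map T \<phi> = \<phi> o\<^sub>L T"


section \<open>The sets \<open>\<C>\<close> and \<open>\<D>\<close>\<close>

lemma set_lebesgue_integral_cong_dom:
  fixes f g w :: "real \<Rightarrow> real"
  assumes rel: "linf_rel T f g" and T: "dom_of T \<in> sets lebesgue"
    and S: "S \<subseteq> dom_of T" "S \<in> sets lebesgue"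
    and w: "w \<in> borel_measurable lebesgue"
  shows "(LINT t:S|lebesgue. f t * w t) = (LINT t:S|lebesgue. g t * w t)"
proof -
  have meas: "(\<lambda>x. indicator S x *\<^sub>R (h x * w x)) \<in> borel_measurable lebesgue"
    if "ess_bounded T h" for h
  proof -
    have "(\<lambda>x. indicator (dom_of T) x *\<^sub>R h x) \<in> borel_measurable lebesgue"
      using that T by (simp add: ess_bounded_def borel_measurable_restrict_space_iff)
    then have "(\<lambda>x. indicator S x *\<^sub>R (indicator (dom_of T) x *\<^sub>R h x * w x)) \<in> borel_measurable lebesgue"
      by (rule borel_measurable_scaleR[OF borel_measurable_indicator[OF S(2)]
            borel_measurable_times[OF _ w]])
    moreover have "(\<lambda>x. indicator S x *\<^sub>R (indicator (dom_of T) x *\<^sub>R h x * w x))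
        = (\<lambda>x. indicator S x *\<^sub>R (h x * w x))"
      using S(1) by (auto simp: fun_eq_iff indicator_def)
    ultimately show ?thesis by simp
  qed
  have "AE x in lebesgue. x \<in> dom_of T \<longrightarrow> f x = g x"
    using rel T by (simp add: linf_rel_def AE_restrict_space_iff)
  then have "AE x in lebesgue. indicator S x *\<^sub>R (f x * w x) = indicator S x *\<^sub>R (g x * w x)"
    by eventually_elim (use S(1) in \<open>auto simp: indicator_def\<close>)
  then show ?thesis
    unfolding set_lebesgue_integral_def using rel
    by (intro integral_cong_AE meas) (auto simp: linf_rel_def)
qed

lift_definition cesaro_mean :: "from_one linf \<Rightarrow> real \<Rightarrow> real"
  is "\<lambda>f x. 1 / x * (LINT t:{1..x}|lebesgue. f t)"
proof
  fix f g x assume "linf_rel TYPE(from_one) f g"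
  from set_lebesgue_integral_cong_dom[OF this, of "{1..x}" "\<lambda>_. 1"]
  show "1 / x * (LINT t:{1..x}|lebesgue. f t) = 1 / x * (LINT t:{1..x}|lebesgue. g t)"
    by (simp add: dom_of_simps)
qed

lift_definition exp_mean :: "from_zero linf \<Rightarrow> real \<Rightarrow> real"
  is "\<lambda>f x. 1 / exp x * (LINT t:{0..x}|lebesgue. f t * exp t)"
proof
  fix f g x assume "linf_rel TYPE(from_zero) f g"
  moreover have "(exp :: real \<Rightarrow> real) \<in> borel_measurable lebesgue"
    by (intro measurable_completion) simp
  ultimately show "1 / exp x * (LINT t:{0..x}|lebesgue. f t * exp t)
      = 1 / exp x * (LINT t:{0..x}|lebesgue. g t * exp t)"
    using set_lebesgue_integral_cong_dom[of "TYPE(from_zero)" f g "{0..x}" exp] by (simp add: dom_of_simps)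
qed

definition has_M :: "from_one linf \<Rightarrow> real \<Rightarrow> bool"
  where "has_M f l \<longleftrightarrow> (cesaro_mean f \<longlongrightarrow> l) at_top"

definition has_R :: "from_zero linf \<Rightarrow> real \<Rightarrow> bool"
  where "has_R f l \<longleftrightarrow> (exp_mean f \<longlongrightarrow> l) at_top"

definition E0 :: "from_one linf set"
  where "E0 = {f. has_M f 0}"

definition F0 :: "from_zero linf set"
  where "F0 = {f. has_R f 0}"

definition C_set :: "(from_one linf \<Rightarrow>\<^sub>L real) set"
  where "C_set = {\<phi>. positive_functional \<phi> \<and> norm \<phi> = 1 \<and> (\<forall>f\<in>E0. blinfun_apply \<phi> f = 0)}"

definition D_set :: "(from_zero linf \<Rightarrow>\<^sub>L real) set"
  where "D_set = {\<phi>. positive_functional \<phi> \<and> norm \<phi> = 1 \<and> (\<forall>f\<in>F0. blinfun_apply \<phi> f = 0)}"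


section \<open>Weak* topology and affine maps\<close>

text \<open>
  For scalar-valued operators the strong operator topology is the topology of pointwise
  convergence, that is, the weak* topology of the dual space.
\<close>

abbreviation weak_star :: "('a::real_normed_vector \<Rightarrow>\<^sub>L real) topology"
  where "weak_star \<equiv> strong_operator_topology"

definition affine_on :: "'a::real_vector set \<Rightarrow> ('a \<Rightarrow> 'b::real_vector) \<Rightarrow> bool"
  where "affine_on S h \<longleftrightarrow> convex S \<and>
    (\<forall>x\<in>S. \<forall>y\<in>S. \<forall>u\<ge>0. \<forall>v\<ge>0. u + v = 1 \<longrightarrow> h (u *\<^sub>R x + v *\<^sub>R y) = u *\<^sub>R h x + v *\<^sub>R h y)"

end

theory Submission
  imports Defs
begin

text \<open>
  Composition with \<open>ln\<close> inverts \<open>W\<close>, and both maps preserve positivity and the constant 1. As the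
  norm of a positive functional is its value at 1, the adjoints preserve positive functionals of
  norm 1. The substitution \<open>t = exp s\<close> turns the mean defining \<open>R\<close> for \<open>W f\<close> at \<open>x\<close> into the Cesaro
  mean of \<open>f\<close> at \<open>exp x\<close>, so \<open>W\<close> maps \<open>E0\<close> onto \<open>F0\<close>. Adjoints are always weak* continuous.
\<close>

lemma exp_differentiable_on: "exp differentiable_on (A :: real set)"
  unfolding differentiable_on_def
  by (meson DERIV_exp differentiable_at_withinI real_differentiable_def)

lemma ln_measurable_half_lines:
  "ln \<in> lebesgue_on {1::real..} \<rightarrow>\<^sub>M lebesgue_on {0::real..}"
proof (rule measurableI)
  show "ln x \<in> space (lebesgue_on {0::real..})" if "x \<in> space (lebesgue_on {1::real..})" for x :: real
    using that by simp
  fix A :: "real set" assume "A \<in> sets (lebesgue_on {0..})"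
  then have A: "A \<in> sets lebesgue" "A \<subseteq> {0..}" by (auto simp: sets_restrict_space_iff)
  have eq: "ln -` A \<inter> space (lebesgue_on {1..}) = exp ` A"
    using A(2) by (force simp: image_iff intro: bexI[where x = "ln _"])
  have "exp ` A \<in> sets lebesgue"
    using A by (intro differentiable_image_in_sets_lebesgue exp_differentiable_on) auto
  moreover have "exp ` A \<subseteq> {1..}" using A(2) by auto
  ultimately show "ln -` A \<inter> space (lebesgue_on {1..}) \<in> sets (lebesgue_on {1..})"
    unfolding eq by (simp add: sets_restrict_space_iff)
qed

text \<open>The exceptional set moves into the image under \<open>exp\<close> of a null set, which
  is negligible because \<open>exp\<close> is differentiable. This makes composition with
  \<open>ln\<close> well defined on equivalence classes.\<close>

lemma AE_ln:
  assumes "AE x in lebesgue_on {0::real..}. P x"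
  shows "AE x in lebesgue_on {1::real..}. P (ln x)"
proof -
  obtain N where N: "N \<in> null_sets (lebesgue_on {0..})"
    "{x \<in> space (lebesgue_on {0..}). \<not> P x} \<subseteq> N"
    using assms by (auto simp: eventually_ae_filter)
  then have N': "N \<in> null_sets lebesgue" "N \<subseteq> {0..}"
    by (auto simp: null_sets_restrict_space)
  have "negligible (exp ` N)"
    using N' by (intro negligible_differentiable_image_negligible exp_differentiable_on)
      (auto simp: negligible_iff_null_sets)
  then have "exp ` N \<in> null_sets (lebesgue_on {1..})"
    using N'(2) by (auto simp: null_sets_restrict_space negligible_iff_null_sets)
  moreover have "{x \<in> space (lebesgue_on {1..}). \<not> P (ln x)} \<subseteq> exp ` N"
  proof
    fix x assume "x \<in> {x \<in> space (lebesgue_on {1..}). \<not> P (ln x)}"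
    then have "ln x \<in> N" "x = exp (ln x)" using N(2) by auto
    then show "x \<in> exp ` N" by blast
  qed
  ultimately show ?thesis by (auto simp: eventually_ae_filter)
qed

lemma ess_bounded_ln:
  assumes "ess_bounded TYPE(from_zero) f"
  shows "ess_bounded TYPE(from_one) (\<lambda>x. f (ln x))"
proof -
  obtain C where "f \<in> borel_measurable (lebesgue_on {0..})" "AE x in lebesgue_on {0..}. \<bar>f x\<bar> \<le> C"
    using assms unfolding ess_bounded_def dom_of_simps by blast
  then show ?thesis
    using measurable_compose[OF ln_measurable_half_lines] AE_ln
    unfolding ess_bounded_def dom_of_simps by blast
qed

lift_definition W_inv_fun :: "from_zero linf \<Rightarrow> from_one linf" is "\<lambda>f x. f (ln x)"
  using ess_bounded_ln AE_ln unfolding linf_rel_def dom_of_simps by blast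

lift_definition W_inv :: "from_zero linf \<Rightarrow>\<^sub>L from_one linf" is W_inv_fun
proof (rule bounded_linear_intro[where K = 1])
  show "W_inv_fun (f + g) = W_inv_fun f + W_inv_fun g" for f g
    by transfer (auto simp: linf_rel_def intro!: ess_bounded_ln ess_bounded_add)
  show "W_inv_fun (r *\<^sub>R f) = r *\<^sub>R W_inv_fun f" for r f
    by transfer (auto simp: linf_rel_def intro!: ess_bounded_ln ess_bounded_scale)
  have "norm (W_inv_fun f) \<le> norm f" for f
  proof transfer
    fix f assume "linf_rel TYPE(from_zero) f f"
    then have b: "ess_bounded TYPE(from_zero) f" by (simp add: linf_rel_def)
    have "AE x in dom_measure TYPE(from_one). \<bar>f (ln x)\<bar> \<le> ess_norm TYPE(from_zero) f"
      using AE_ln[of "\<lambda>x. \<bar>f x\<bar> \<le> ess_norm TYPE(from_zero) f"] ess_norm_AE[OF b]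
      unfolding dom_of_simps by blast
    then show "ess_norm TYPE(from_one) (\<lambda>x. f (ln x)) \<le> ess_norm TYPE(from_zero) f"
      by (intro ess_norm_least ess_bounded_ln b ess_norm_nonneg)
  qed
  then show "norm (W_inv_fun f) \<le> norm f * 1" for f by simp
qed

lemma W_W_inv: "blinfun_apply W (blinfun_apply W_inv f) = f"
proof -
  have "W_fun (W_inv_fun f) = f"
    by transfer (auto simp: linf_rel_def intro!: ess_bounded_ln ess_bounded_exp)
  then show ?thesis by (simp add: W.rep_eq W_inv.rep_eq)
qed

lemma W_inv_W: "blinfun_apply W_inv (blinfun_apply W f) = f"
proof -
  have "W_inv_fun (W_fun f) = f"
  proof transfer
    fix f assume f: "linf_rel TYPE(from_one) f f"
    \<comment> \<open>The identity \<open>exp (ln x) = x\<close> requires \<open>x > 0\<close>, so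
      the restriction to the domain matters here, whereas \<open>ln (exp x) = x\<close> holds on all
      reals.\<close>
    have "AE x in lebesgue_on {1..}. f (exp (ln x)) = f x"
      by (rule AE_I2) simp
    with f show "linf_rel TYPE(from_one) (\<lambda>x. f (exp (ln x))) f"
      unfolding linf_rel_def dom_of_simps
      using ess_bounded_ln[OF ess_bounded_exp] by blast
  qed
  then show ?thesis by (simp add: W.rep_eq W_inv.rep_eq)
qed

lemma nonneg_W: "nonneg_linf f \<Longrightarrow> nonneg_linf (blinfun_apply W f)"
  unfolding W.rep_eq by transfer (unfold dom_of_simps, rule AE_exp)

lemma nonneg_W_inv: "nonneg_linf f \<Longrightarrow> nonneg_linf (blinfun_apply W_inv f)"
  unfolding W_inv.rep_eq by transfer (unfold dom_of_simps, rule AE_ln)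

lift_definition one_linf :: "'a::domain_tag linf" is "\<lambda>x. 1"
  by (simp add: linf_rel_def ess_bounded_const)

lemma W_one: "blinfun_apply W one_linf = one_linf"
  unfolding W.rep_eq by transfer (simp add: linf_rel_def ess_bounded_const)

lemma W_inv_one: "blinfun_apply W_inv one_linf = one_linf"
  using W_inv_W[of one_linf] by (simp add: W_one)

text \<open>The constant 1 is an order unit: \<open>f\<close> lies almost everywhere between
  \<open>- norm f\<close> and \<open>norm f\<close>, so positivity bounds the absolute value of
  \<open>\<phi> f\<close> by \<open>\<phi> one_linf * norm f\<close>.\<close>

lemma norm_positive_functional:
  fixes \<phi> :: "'a::domain_tag linf \<Rightarrow>\<^sub>L real"
  assumes "positive_functional \<phi>"
  shows "norm \<phi> = blinfun_apply \<phi> one_linf"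
proof (rule antisym)
  have pos: "0 \<le> blinfun_apply \<phi> f" if "nonneg_linf f" for f
    using assms that by (simp add: positive_functional_def)
  have 1: "nonneg_linf (norm f *\<^sub>R one_linf + f)" "nonneg_linf (norm f *\<^sub>R one_linf - f)"
    for f :: "'a linf"
    by (transfer, unfold linf_rel_def, clarify, drule ess_norm_AE,
        erule eventually_mono, linarith)+
  show "norm \<phi> \<le> blinfun_apply \<phi> one_linf"
  proof (rule norm_blinfun_bound)
    show "0 \<le> blinfun_apply \<phi> one_linf"
      by (rule pos, transfer) simp
    show "norm (blinfun_apply \<phi> f) \<le> blinfun_apply \<phi> one_linf * norm f" for f
      using pos[OF 1(1)[of f]] pos[OF 1(2)[of f]]
      by (simp add: blinfun.add_right blinfun.diff_right blinfun.scaleR_right mult.commute abs_le_iff)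
  qed
  \<comment> \<open>Equality can fail for a general tag: over a null domain \<open>one_linf\<close>
    is zero.\<close>
  have "norm (one_linf :: 'a linf) \<le> 1"
    by transfer (simp add: ess_norm_least ess_bounded_const)
  then have "norm \<phi> * norm (one_linf :: 'a linf) \<le> norm \<phi> * 1"
    by (intro mult_left_mono) auto
  moreover have "blinfun_apply \<phi> one_linf \<le> norm \<phi> * norm (one_linf :: 'a linf)"
    using norm_blinfun[of \<phi> "one_linf"] by simp
  ultimately show "blinfun_apply \<phi> one_linf \<le> norm \<phi>" by simp
qed

text \<open>The Jacobian of the substitution \<open>t = exp s\<close> is exactly the weight in
  \<open>exp_mean\<close>. For negative \<open>x\<close> both intervals are empty and both sides
  vanish.\<close>

lemma exp_mean_W: "exp_mean (blinfun_apply W f) x = cesaro_mean f (exp x)"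
  unfolding W.rep_eq
proof transfer
  fix f :: "real \<Rightarrow> real" and x :: real
  assume "linf_rel TYPE(from_one) f f"
  then obtain C where f: "f \<in> borel_measurable (lebesgue_on {1..})"
    and C: "AE t in lebesgue_on {1..}. \<bar>f t\<bar> \<le> C"
    unfolding linf_rel_def ess_bounded_def dom_of_simps by blast
  have img: "exp ` {0..x} = {1..exp x}"
  proof
    show "{1..exp x} \<subseteq> exp ` {0..x}"
    proof
      fix y assume "y \<in> {1..exp x}"
      then have "y = exp (ln y)" "ln y \<in> {0..x}"
        using ln_le_cancel_iff[of y "exp x"] by auto
      then show "y \<in> exp ` {0..x}" by blast
    qed
  qed auto
  \<comment> \<open>An essentially bounded function is integrable on an interval of finite
    measure.\<close>
  have "set_integrable lebesgue {1..exp x} f"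
  proof -
    have "AE t in lebesgue. t \<in> {1..} \<longrightarrow> \<bar>f t\<bar> \<le> C"
      using C by (simp add: AE_restrict_space_iff)
    moreover have "f \<in> borel_measurable (lebesgue_on {1..exp x})"
      using f by (rule measurable_restrict_mono) auto
    ultimately show ?thesis
      unfolding set_integrable_def
      by (intro integrableI_bounded_set[where A = "{1..exp x}" and B = C])
        (auto simp: borel_measurable_restrict_space_iff emeasure_lborel_Icc_eq)
  qed
  then have abs: "f absolutely_integrable_on exp ` {0..x}" by (simp add: img)
  \<comment> \<open>The change of variables is stated for gauge integrals; absolute integrability on
    both sides then allows the return to Lebesgue integrals.\<close>
  have "((\<lambda>t. \<bar>exp t\<bar> * f (exp t)) absolutely_integrable_on {0..x}) \<and>
      integral {0..x} (\<lambda>t. \<bar>exp t\<bar> * f (exp t)) = integral (exp ` {0..x}) f"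
    by (subst has_absolute_integral_change_of_variables_1')
      (auto simp: abs intro!: derivative_eq_intros inj_onI)
  then have "(LINT t:{0..x}|lebesgue. f (exp t) * exp t) = (LINT t:{1..exp x}|lebesgue. f t)"
    using abs by (simp add: set_lebesgue_integral_eq_integral img mult.commute)
  then show "1 / exp x * (LINT t:{0..x}|lebesgue. f (exp t) * exp t)
      = 1 / exp x * (LINT t:{1..exp x}|lebesgue. f t)" by simp
qed

text \<open>Both \<open>exp\<close> and \<open>ln\<close> tend to infinity at infinity, so the limit
  transfers in either direction.\<close>

lemma has_R_W: "has_R (blinfun_apply W f) l \<longleftrightarrow> has_M f l"
proof
  assume "has_M f l"
  then show "has_R (blinfun_apply W f) l"
    unfolding has_M_def has_R_def exp_mean_W[abs_def]
    by (rule filterlim_compose[OF _ exp_at_top])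
next
  assume "has_R (blinfun_apply W f) l"
  then have "((\<lambda>x. cesaro_mean f (exp (ln x))) \<longlongrightarrow> l) at_top"
    unfolding has_R_def exp_mean_W[abs_def]
    by (rule filterlim_compose[OF _ ln_at_top])
  moreover have "\<forall>\<^sub>F x in at_top. cesaro_mean f (exp (ln x)) = cesaro_mean f x"
    using eventually_gt_at_top[of 0] by eventually_elim simp
  ultimately show "has_M f l"
    unfolding has_M_def by (rule Lim_transform_eventually)
qed

lemma W_in_F0_iff: "blinfun_apply W f \<in> F0 \<longleftrightarrow> f \<in> E0"
  by (simp add: E0_def F0_def has_R_W)

lemma dual_map_apply: "blinfun_apply (dual_map T \<phi>) f = blinfun_apply \<phi> (blinfun_apply T f)"
  by (simp add: dual_map_def)

lemma positive_functional_dual_map: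
  assumes "\<And>f. nonneg_linf f \<Longrightarrow> nonneg_linf (blinfun_apply T f)" "positive_functional \<phi>"
  shows "positive_functional (dual_map T \<phi>)"
  using assms by (simp add: positive_functional_def dual_map_apply)

text \<open>The norm stays 1 because both norms are values at \<open>one_linf\<close>, which
  \<open>W\<close> preserves.\<close>

lemma dual_map_W_D_set: "\<phi> \<in> D_set \<Longrightarrow> dual_map W \<phi> \<in> C_set"
  by (auto simp: D_set_def C_set_def positive_functional_dual_map nonneg_W
      norm_positive_functional dual_map_apply W_one W_in_F0_iff)

lemma dual_map_W_inv_C_set:
  assumes "\<psi> \<in> C_set"
  shows "dual_map W_inv \<psi> \<in> D_set"
proof -
  \<comment> \<open>Since \<open>f\<close> is the image of \<open>W_inv f\<close> under
    \<open>W\<close>, the equivalence for \<open>W\<close> also settles the inverse.\<close>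
  have "blinfun_apply W_inv f \<in> E0" if "f \<in> F0" for f
    using that W_in_F0_iff[of "blinfun_apply W_inv f"] by (simp add: W_W_inv)
  with assms show ?thesis
    by (auto simp: D_set_def C_set_def positive_functional_dual_map nonneg_W_inv
        norm_positive_functional dual_map_apply W_inv_one)
qed

lemma dual_map_W_W_inv: "dual_map W (dual_map W_inv \<psi>) = \<psi>"
  by (rule blinfun_eqI) (simp add: dual_map_apply W_inv_W)

lemma dual_map_W_inv_W: "dual_map W_inv (dual_map W \<phi>) = \<phi>"
  by (rule blinfun_eqI) (simp add: dual_map_apply W_W_inv)

text \<open>Weak* continuity is tested pointwise, and evaluating the image of \<phi> at
  \<open>f\<close> is evaluating \<phi> at \<open>T f\<close>.\<close>

lemma continuous_map_weak_star_dual_map: "continuous_map weak_star weak_star (dual_map T)"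
  by (simp add: continuous_on_strong_operator_topo_iff_coordinatewise dual_map_apply
      strong_operator_topology_continuous_evaluation)

text \<open>The unit sphere is not convex in general, but on positive functionals the norm is
  evaluation at \<open>one_linf\<close> and so respects convex combinations.\<close>

lemma convex_D_set: "convex D_set"
proof (rule convexI)
  fix \<phi> \<psi> and u v :: real
  assume D: "\<phi> \<in> D_set" "\<psi> \<in> D_set" and uv: "0 \<le> u" "0 \<le> v" "u + v = 1"
  let ?\<chi> = "u *\<^sub>R \<phi> + v *\<^sub>R \<psi>"
  have "positive_functional ?\<chi>"
    using D uv by (auto simp: D_set_def positive_functional_def plus_blinfun.rep_eq scaleR_blinfun.rep_eq)
  moreover from this have "norm ?\<chi> = 1"
    using D uv by (auto simp: D_set_def norm_positive_functional plus_blinfun.rep_eq scaleR_blinfun.rep_eq)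
  ultimately show "?\<chi> \<in> D_set"
    using D by (simp add: D_set_def plus_blinfun.rep_eq scaleR_blinfun.rep_eq)
qed

theorem mainTheorem4:
  shows "dual_map W ` D_set = C_set \<and>
    affine_on D_set (dual_map W) \<and>
    homeomorphic_map (subtopology weak_star D_set) (subtopology weak_star C_set) (dual_map W)"
proof (intro conjI)
  show "dual_map W ` D_set = C_set"
    by (metis dual_map_W_D_set dual_map_W_inv_C_set dual_map_W_W_inv image_eqI image_subsetI
        subset_antisym subsetI)
  show "affine_on D_set (dual_map W)"
    by (auto simp: affine_on_def convex_D_set dual_map_apply plus_blinfun.rep_eq
        scaleR_blinfun.rep_eq intro!: blinfun_eqI)
  \<comment> \<open>The inverse is the adjoint of \<open>W_inv\<close>; both adjoints are continuous
    on the whole dual, hence on the subspaces.\<close>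
  have "homeomorphic_maps (subtopology weak_star D_set) (subtopology weak_star C_set)
      (dual_map W) (dual_map W_inv)"
    unfolding homeomorphic_maps_def continuous_map_in_subtopology
    by (auto simp: continuous_map_from_subtopology continuous_map_weak_star_dual_map
        dual_map_W_D_set dual_map_W_inv_C_set dual_map_W_W_inv dual_map_W_inv_W)
  then show "homeomorphic_map (subtopology weak_star D_set) (subtopology weak_star C_set) (dual_map W)"
    using homeomorphic_maps_imp_map by blast
qed

end
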